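(* Let $(G,\varphi_{MT})$ be a mode-target game with $m$ modes $M_1,\dots,M_m$ and targets $T_{i,1},\dots,T_{i,t_i}$ for mode $i$, so that $\varphi_{MT}=\bigwedge_{i=1}^m\left(\Diamond\square M_i\implies\bigvee_{j=1}^{t_i}\Diamond\square T_{i,j}\right)$. Define $\bar T_{i,j}=T_{i,j}$ if $j\le t_i$ and $\bar T_{i,j}=\mathtt{false}$ otherwise. Then the game is equivalent to the GR(1) game $(G,\varphi)$ with $$\varphi=\left(\bigwedge_{j=1}^{\max_it_i}\square\Diamond\bigwedge_{i=1}^m(\neg M_i\vee\neg\bar T_{i,j})\right)\implies\left(\bigwedge_{i=1}^m\square\Diamond\neg M_i\right),$$ i.e., $W_G(\varphi_{MT})=W_G(\varphi)$.
   Context: LTL: over a set $P$ of atomic propositions, formulas are built from $p\in P$, $\neg$, $\vee$, $\bigcirc$ (next), $\mathcal U$ (until), with the usual semantics over infinite words in $(2^P)^\omega$; $\wedge$, $\implies$, $\Diamond$ (eventually), $\square$ (always) are the usual abbreviations. $W(\varphi)$ is the set of infinite words satisfying $\varphi$ at time 0. Games: a game graph $G=(V,E,P,L)$ has a finite state set $V=V_0\sqcup V_1$ (player $k$ moves at states of $V_k$), a transition relation $E\subseteq V\times V$ such that every state has at least one successor, a finite set $P$ of atomic propositions and a labeling $L:V\to2^P$, extended letterwise to infinite sequences. A play is an infinite sequence $v_0v_1\ldots$ with $(v_i,v_{i+1})\in E$ for all $i$; $\Omega(G)$ is the set of all plays and $W_G(\varphi)=W(\varphi)\cap L(\Omega(G))$.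 An LTL game is a pair $(G,\varphi)$ with $\varphi$ an LTL formula; a play $r$ is winning for player 0 if $L(r)\in W(\varphi)$. Mode-target (MT) game: an LTL game $(G,\varphi)$ where $G=(V,E,M\cup T,L)$, $M=\{M_1,\dots,M_m\}$ (modes), $T=\bigcup_iT_i$, $T_i=\{T_{i,1},\dots,T_{i,t_i}\}$ (targets of mode $i$) are finite sets of atomic propositions, the modes are mutually exclusive ($M_i\in L(v)\Rightarrow M_j\notin L(v)$ for all $j\ne i$ and $v\in V$), and $\varphi=\bigwedge_{i=1}^m\left(\Diamond\square M_i\implies\bigvee_{j=1}^{t_i}\Diamond\square T_{i,j}\right)$. GR(1) game: an LTL game whose winning condition has the form $\bigwedge_{i_1\in I_1}\square\Diamond a_{i_1}\implies\bigwedge_{i_2\in I_2}\square\Diamond g_{i_2}$ with $I_1,I_2$ finite and $a_{i_1},g_{i_2}$ positional formulas (no temporal operators). *)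

theory Defs
  imports Main "HOL-Library.Omega_Words_Fun"
begin

(* The constant true is a constructor because it cannot be obtained as "p or not p" when there
   are no atomic propositions; it is the value of the empty conjunction. *)
datatype (atoms: 'p) ltl =
    TT                                       ("true\<^sub>l")
  | Prop 'p                                  ("prop\<^sub>l'(_')")
  | Neg "'p ltl"                             ("\<not>\<^sub>l _" [85] 85)
  | Or "'p ltl" "'p ltl"                     (infixr "\<or>\<^sub>l" 60)
  | Next "'p ltl"                            ("\<circle>\<^sub>l _" [85] 85)
  | Until "'p ltl" "'p ltl"                  (infixr "\<U>\<^sub>l" 70)

definition FF :: "'p ltl" ("false\<^sub>l") where
  "false\<^sub>l = \<not>\<^sub>l true\<^sub>l"

definition And :: "'p ltl \<Rightarrow> 'p ltl \<Rightarrow> 'p ltl" (infixr "\<and>\<^sub>l" 65) where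
  "\<phi> \<and>\<^sub>l \<psi> = \<not>\<^sub>l (\<not>\<^sub>l \<phi> \<or>\<^sub>l \<not>\<^sub>l \<psi>)"

definition Implies :: "'p ltl \<Rightarrow> 'p ltl \<Rightarrow> 'p ltl" (infixr "\<rightarrow>\<^sub>l" 55) where
  "\<phi> \<rightarrow>\<^sub>l \<psi> = \<not>\<^sub>l \<phi> \<or>\<^sub>l \<psi>"

definition Eventually :: "'p ltl \<Rightarrow> 'p ltl" ("\<diamond>\<^sub>l _" [85] 85) where
  "\<diamond>\<^sub>l \<phi> = true\<^sub>l \<U>\<^sub>l \<phi>"

definition Always :: "'p ltl \<Rightarrow> 'p ltl" ("\<box>\<^sub>l _" [85] 85) where
  "\<box>\<^sub>l \<phi> = \<not>\<^sub>l (\<diamond>\<^sub>l (\<not>\<^sub>l \<phi>))"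

fun Conj_list :: "'p ltl list \<Rightarrow> 'p ltl" where
  "Conj_list [] = true\<^sub>l"
| "Conj_list [\<phi>] = \<phi>"
| "Conj_list (\<phi> # \<psi> # \<psi>s) = \<phi> \<and>\<^sub>l Conj_list (\<psi> # \<psi>s)"

fun Disj_list :: "'p ltl list \<Rightarrow> 'p ltl" where
  "Disj_list [] = false\<^sub>l"
| "Disj_list [\<phi>] = \<phi>"
| "Disj_list (\<phi> # \<psi> # \<psi>s) = \<phi> \<or>\<^sub>l Disj_list (\<psi> # \<psi>s)"

abbreviation Conj_upto :: "nat \<Rightarrow> (nat \<Rightarrow> 'p ltl) \<Rightarrow> 'p ltl" where
  "Conj_upto n \<phi> \<equiv> Conj_list (map \<phi> [1..<Suc n])"

abbreviation Disj_upto :: "nat \<Rightarrow> (nat \<Rightarrow> 'p ltl) \<Rightarrow> 'p ltl" where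
  "Disj_upto n \<phi> \<equiv> Disj_list (map \<phi> [1..<Suc n])"

syntax
  "_Conj_upto" :: "pttrn \<Rightarrow> nat \<Rightarrow> 'p ltl \<Rightarrow> 'p ltl" ("(3\<And>\<^sub>l_=1.._./ _)" [0, 51, 50] 50)
  "_Disj_upto" :: "pttrn \<Rightarrow> nat \<Rightarrow> 'p ltl \<Rightarrow> 'p ltl" ("(3\<Or>\<^sub>l_=1.._./ _)" [0, 51, 50] 50)
translations
  "\<And>\<^sub>l i=1..n. \<phi>" \<rightleftharpoons> "CONST Conj_upto n (\<lambda>i. \<phi>)"
  "\<Or>\<^sub>l i=1..n. \<phi>" \<rightleftharpoons> "CONST Disj_upto n (\<lambda>i. \<phi>)"

primrec sat :: "'p set word \<Rightarrow> nat \<Rightarrow> 'p ltl \<Rightarrow> bool" where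
  "sat w n true\<^sub>l \<longleftrightarrow> True"
| "sat w n (prop\<^sub>l(p)) \<longleftrightarrow> p \<in> w n"
| "sat w n (\<not>\<^sub>l \<phi>) \<longleftrightarrow> \<not> sat w n \<phi>"
| "sat w n (\<phi> \<or>\<^sub>l \<psi>) \<longleftrightarrow> sat w n \<phi> \<or> sat w n \<psi>"
| "sat w n (\<circle>\<^sub>l \<phi>) \<longleftrightarrow> sat w (Suc n) \<phi>"
| "sat w n (\<phi> \<U>\<^sub>l \<psi>) \<longleftrightarrow> (\<exists>k\<ge>n. sat w k \<psi> \<and> (\<forall>l. n \<le> l \<and> l < k \<longrightarrow> sat w l \<phi>))"

lemma sat_derived [simp]:
  "\<not> sat w n false\<^sub>l"
  "sat w n (\<phi> \<and>\<^sub>l \<psi>) \<longleftrightarrow> sat w n \<phi> \<and> sat w n \<psi>"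
  "sat w n (\<phi> \<rightarrow>\<^sub>l \<psi>) \<longleftrightarrow> (sat w n \<phi> \<longrightarrow> sat w n \<psi>)"
  "sat w n (\<diamond>\<^sub>l \<phi>) \<longleftrightarrow> (\<exists>k\<ge>n. sat w k \<phi>)"
  "sat w n (\<box>\<^sub>l \<phi>) \<longleftrightarrow> (\<forall>k\<ge>n. sat w k \<phi>)"
  by (auto simp: FF_def And_def Implies_def Eventually_def Always_def)

lemma sat_Conj_list [simp]: "sat w n (Conj_list \<phi>s) \<longleftrightarrow> (\<forall>\<phi>\<in>set \<phi>s. sat w n \<phi>)"
  by (induction \<phi>s rule: Conj_list.induct) auto

lemma sat_Disj_list [simp]: "sat w n (Disj_list \<phi>s) \<longleftrightarrow> (\<exists>\<phi>\<in>set \<phi>s. sat w n \<phi>)"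
  by (induction \<phi>s rule: Disj_list.induct) auto

definition words_of :: "'p set \<Rightarrow> 'p ltl \<Rightarrow> 'p set word set" where
  "words_of P \<phi> = {w. (\<forall>n. w n \<subseteq> P) \<and> sat w 0 \<phi>}"

primrec positional :: "'p ltl \<Rightarrow> bool" where
  "positional true\<^sub>l \<longleftrightarrow> True"
| "positional (prop\<^sub>l(p)) \<longleftrightarrow> True"
| "positional (\<not>\<^sub>l \<phi>) \<longleftrightarrow> positional \<phi>"
| "positional (\<phi> \<or>\<^sub>l \<psi>) \<longleftrightarrow> positional \<phi> \<and> positional \<psi>"
| "positional (\<circle>\<^sub>l \<phi>) \<longleftrightarrow> False"
| "positional (\<phi> \<U>\<^sub>l \<psi>) \<longleftrightarrow> False"

record ('v, 'p) graph =
  states :: "'v set"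
  player :: "nat \<Rightarrow> 'v set"    \<comment> \<open>only the indices 0 and 1 are meaningful\<close>
  edges :: "('v \<times> 'v) set"
  props :: "'p set"
  label :: "'v \<Rightarrow> 'p set"

definition game_graph :: "('v, 'p) graph \<Rightarrow> bool" where
  "game_graph G \<longleftrightarrow>
     finite (states G) \<and>
     states G = player G 0 \<union> player G 1 \<and> player G 0 \<inter> player G 1 = {} \<and>
     edges G \<subseteq> states G \<times> states G \<and>
     (\<forall>v\<in>states G. \<exists>v'. (v, v') \<in> edges G) \<and>
     finite (props G) \<and>
     (\<forall>v\<in>states G. label G v \<subseteq> props G)"

definition plays :: "('v, 'p) graph \<Rightarrow> 'v word set" where
  "plays G = {r. \<forall>n. (r n, r (Suc n)) \<in> edges G}"

definition game_words :: "('v, 'p) graph \<Rightarrow> 'p ltl \<Rightarrow> 'p set word set" where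
  "game_words G \<phi> = words_of (props G) \<phi> \<inter> (\<lambda>r. label G \<circ> r) ` plays G"

definition ltl_game :: "('v, 'p) graph \<Rightarrow> 'p ltl \<Rightarrow> bool" where
  "ltl_game G \<phi> \<longleftrightarrow> game_graph G \<and> atoms \<phi> \<subseteq> props G"

definition mode_target_game ::
  "('v, 'p) graph \<Rightarrow> 'p ltl \<Rightarrow> nat \<Rightarrow> (nat \<Rightarrow> 'p) \<Rightarrow> (nat \<Rightarrow> nat) \<Rightarrow> (nat \<Rightarrow> nat \<Rightarrow> 'p) \<Rightarrow> bool" where
  "mode_target_game G \<phi> m M t T \<longleftrightarrow>
     ltl_game G \<phi> \<and>
     props G = M ` {1..m} \<union> (\<Union>i\<in>{1..m}. T i ` {1..t i}) \<and>
     (\<forall>v\<in>states G. \<forall>i\<in>{1..m}. \<forall>j\<in>{1..m}. j \<noteq> i \<longrightarrow> M i \<in> label G v \<longrightarrow> M j \<notin> label G v) \<and>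
     \<phi> = (\<And>\<^sub>l i=1..m. (\<diamond>\<^sub>l \<box>\<^sub>l prop\<^sub>l(M i) \<rightarrow>\<^sub>l (\<Or>\<^sub>l j=1..t i. \<diamond>\<^sub>l \<box>\<^sub>l prop\<^sub>l(T i j))))"

definition gr1_game :: "('v, 'p) graph \<Rightarrow> 'p ltl \<Rightarrow> bool" where
  "gr1_game G \<phi> \<longleftrightarrow>
     ltl_game G \<phi> \<and>
     (\<exists>as gs. (\<forall>a\<in>set as. positional a) \<and> (\<forall>g\<in>set gs. positional g) \<and>
        \<phi> = (Conj_list (map (\<lambda>a. \<box>\<^sub>l \<diamond>\<^sub>l a) as) \<rightarrow>\<^sub>l Conj_list (map (\<lambda>g. \<box>\<^sub>l \<diamond>\<^sub>l g) gs)))"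

definition padded_target :: "(nat \<Rightarrow> nat) \<Rightarrow> (nat \<Rightarrow> nat \<Rightarrow> 'p) \<Rightarrow> nat \<Rightarrow> nat \<Rightarrow> 'p ltl" where
  "padded_target t T i j = (if j \<le> t i then prop\<^sub>l(T i j) else false\<^sub>l)"

end

theory Submission
  imports Defs
begin

text \<open>
  On a word eventually staying in mode \<open>i\<close>, mutual exclusivity makes the positional formula
  \<open>\<And>\<^sub>i (\<not>M\<^sub>i \<or> \<not>T\<^sub>i\<^sub>j)\<close> eventually equivalent to \<open>\<not>T\<^sub>i\<^sub>j\<close>. Hence the assumption with index \<open>j\<close>
  of the GR(1) condition fails iff target \<open>T\<^sub>i\<^sub>j\<close> eventually holds forever, while the guarantee
  with index \<open>i\<close> fails. On all other words both conditions hold trivially.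
\<close>

lemma atoms_derived [simp]:
  "atoms false\<^sub>l = {}"
  "atoms (\<phi> \<and>\<^sub>l \<psi>) = atoms \<phi> \<union> atoms \<psi>"
  "atoms (\<phi> \<rightarrow>\<^sub>l \<psi>) = atoms \<phi> \<union> atoms \<psi>"
  "atoms (\<diamond>\<^sub>l \<phi>) = atoms \<phi>"
  "atoms (\<box>\<^sub>l \<phi>) = atoms \<phi>"
  by (simp_all add: FF_def And_def Implies_def Eventually_def Always_def)

lemma atoms_Conj_list [simp]: "atoms (Conj_list \<phi>s) = (\<Union>\<phi>\<in>set \<phi>s. atoms \<phi>)"
  by (induction \<phi>s rule: Conj_list.induct) auto

lemma positional_derived [simp]:
  "positional false\<^sub>l"
  "positional (\<phi> \<and>\<^sub>l \<psi>) \<longleftrightarrow> positional \<phi> \<and> positional \<psi>"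
  by (simp_all add: FF_def And_def)

lemma positional_Conj_list [simp]: "positional (Conj_list \<phi>s) \<longleftrightarrow> (\<forall>\<phi>\<in>set \<phi>s. positional \<phi>)"
  by (induction \<phi>s rule: Conj_list.induct) auto

lemma positional_padded_target [simp]: "positional (padded_target t T i j)"
  by (simp add: padded_target_def)

lemma atoms_padded_target: "atoms (padded_target t T i j) = (if j \<le> t i then {T i j} else {})"
  by (simp add: padded_target_def)

lemma sat_padded_target [simp]:
  "sat w n (padded_target t T i j) \<longleftrightarrow> j \<le> t i \<and> T i j \<in> w n"
  by (simp add: padded_target_def)

text \<open>The temporal core, freed from syntax and games: \<open>A i n\<close> reads as mode
  \<open>i\<close> at time \<open>n\<close>, \<open>B i j n\<close> as its target \<open>j\<close>
  at that time. One index set \<open>J\<close> serves all modes, matching the padded targets.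
  Exclusivity enters from right to left.\<close>

lemma mode_target_iff_gr1:
  fixes A :: "'i \<Rightarrow> nat \<Rightarrow> bool" and B :: "'i \<Rightarrow> 'j \<Rightarrow> nat \<Rightarrow> bool"
  assumes excl: "\<And>n i i'. i \<in> I \<Longrightarrow> i' \<in> I \<Longrightarrow> A i n \<Longrightarrow> A i' n \<Longrightarrow> i' = i"
  shows "(\<forall>i\<in>I. (\<exists>k. \<forall>n\<ge>k. A i n) \<longrightarrow> (\<exists>j\<in>J. \<exists>k. \<forall>n\<ge>k. B i j n)) \<longleftrightarrow>
    ((\<forall>j\<in>J. \<forall>k. \<exists>n\<ge>k. \<forall>i\<in>I. \<not> A i n \<or> \<not> B i j n) \<longrightarrow> (\<forall>i\<in>I. \<forall>k. \<exists>n\<ge>k. \<not> A i n))"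
    (is "?MT \<longleftrightarrow> (?assm \<longrightarrow> ?guar)")
proof
  assume mt: ?MT
  show "?assm \<longrightarrow> ?guar"
  proof (intro impI ballI allI, rule ccontr)
    fix i k
    assume a: ?assm and i: "i \<in> I" and "\<not> (\<exists>n\<ge>k. \<not> A i n)"
    then have A: "\<forall>n\<ge>k. A i n" by blast
    with mt i obtain j k' where j: "j \<in> J" and B: "\<forall>n\<ge>k'. B i j n" by blast
    \<comment> \<open>Past both thresholds mode \<open>i\<close> and its target \<open>j\<close>
      hold at every time, which contradicts the assumption for \<open>j\<close> at conjunct
      \<open>i\<close>.\<close>
    from a j obtain n where "n \<ge> max k k'" "\<not> A i n \<or> \<not> B i j n" using i by meson
    with A B show False by simp
  qed
next
  assume gr1: "?assm \<longrightarrow> ?guar"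
  show ?MT
  proof (intro ballI impI)
    fix i
    assume i: "i \<in> I" and "\<exists>k. \<forall>n\<ge>k. A i n"
    then obtain k where A: "\<forall>n\<ge>k. A i n" by blast
    with gr1 i have "\<not> ?assm" by blast
    then obtain j k' where j: "j \<in> J" and k': "\<forall>n\<ge>k'. \<exists>i'\<in>I. A i' n \<and> B i' j n" by blast
    \<comment> \<open>The witness \<open>i'\<close> in \<open>k'\<close> may vary with
      \<open>n\<close>. Once \<open>n\<close> is also at least \<open>k\<close>, mode
      \<open>i\<close> is active too, so \<open>excl\<close> forces \<open>i'\<close> to be
      \<open>i\<close>.\<close>
    have "B i j n" if "n \<ge> max k k'" for n
      using that k' A excl[OF i] by (metis max.bounded_iff)
    with j show "\<exists>j\<in>J. \<exists>k. \<forall>n\<ge>k. B i j n" by blast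
  qed
qed

theorem proposition5:
  fixes G :: "('v, 'p) graph" and \<phi>MT \<phi> :: "'p ltl"
    and m :: nat and M :: "nat \<Rightarrow> 'p" and t :: "nat \<Rightarrow> nat" and T :: "nat \<Rightarrow> nat \<Rightarrow> 'p"
  assumes "mode_target_game G \<phi>MT m M t T"
    and "\<phi> = ((\<And>\<^sub>l j=1..Max (insert 0 (t ` {1..m})).
                  \<box>\<^sub>l \<diamond>\<^sub>l (\<And>\<^sub>l i=1..m. (\<not>\<^sub>l prop\<^sub>l(M i) \<or>\<^sub>l \<not>\<^sub>l padded_target t T i j)))
              \<rightarrow>\<^sub>l (\<And>\<^sub>l i=1..m. \<box>\<^sub>l \<diamond>\<^sub>l \<not>\<^sub>l prop\<^sub>l(M i)))"
  shows "gr1_game G \<phi> \<and> game_words G \<phi>MT = game_words G \<phi>"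
proof
  let ?N = "Max (insert 0 (t ` {1..m}))"
  let ?a = "\<lambda>j. \<And>\<^sub>l i=1..m. (\<not>\<^sub>l prop\<^sub>l(M i) \<or>\<^sub>l \<not>\<^sub>l padded_target t T i j)"
  let ?g = "\<lambda>i. \<not>\<^sub>l prop\<^sub>l(M i)"
  note mt = assms(1)[unfolded mode_target_game_def]
  have game: "game_graph G" using mt by (simp add: ltl_game_def)
  have props: "props G = M ` {1..m} \<union> (\<Union>i\<in>{1..m}. T i ` {1..t i})" using mt by blast
  \<comment> \<open>Padding with \<open>false\<close> contributes no atoms, so an index
    \<open>j\<close> beyond \<open>t i\<close> never brings in a \<open>T i j\<close> that might lie
    outside \<open>props G\<close>.\<close>
  have "atoms \<phi> \<subseteq> props G"
    unfolding assms(2) props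
    by (fastforce simp: atoms_padded_target simp del: upt_Suc split: if_splits)
  moreover have "\<phi> = (Conj_list (map (\<lambda>a. \<box>\<^sub>l \<diamond>\<^sub>l a) (map ?a [1..<Suc ?N])) \<rightarrow>\<^sub>l
      Conj_list (map (\<lambda>g. \<box>\<^sub>l \<diamond>\<^sub>l g) (map ?g [1..<Suc m])))"
    unfolding assms(2) by (simp only: map_map o_def)
  moreover have "\<forall>a\<in>set (map ?a [1..<Suc ?N]). positional a" "\<forall>g\<in>set (map ?g [1..<Suc m]). positional g"
    by (auto simp del: upt_Suc)
  ultimately show "gr1_game G \<phi>"
    unfolding gr1_game_def ltl_game_def using game by blast

  have "sat (label G \<circ> r) 0 \<phi>MT \<longleftrightarrow> sat (label G \<circ> r) 0 \<phi>" if r: "r \<in> plays G" for r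
  proof -
    let ?A = "\<lambda>i n. M i \<in> label G (r n)"
    let ?B = "\<lambda>i j n. j \<le> t i \<and> T i j \<in> label G (r n)"
    \<comment> \<open>Exclusivity is given only at states of \<open>G\<close>; every position of a
      play is the source of an edge, hence a state.\<close>
    have "r n \<in> states G" for n
      using r game by (auto simp: plays_def game_graph_def)
    then have excl: "i' = i" if "i \<in> {1..m}" "i' \<in> {1..m}" "?A i n" "?A i' n" for n i i'
      using mt that by blast
    have le: "t i \<le> ?N" if "i \<in> {1..m}" for i
      using that by (intro Max_ge) auto
    have "sat (label G \<circ> r) 0 \<phi>MT \<longleftrightarrow>
        (\<forall>i\<in>{1..m}. (\<exists>k. \<forall>n\<ge>k. ?A i n) \<longrightarrow>
          (\<exists>j\<in>{1..t i}. \<exists>k. \<forall>n\<ge>k. T i j \<in> label G (r n)))"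
      using mt by (simp add: atLeastLessThanSuc_atLeastAtMost del: upt_Suc)
    \<comment> \<open>The mode-dependent range of \<open>j\<close> is widened to the common bound
      \<open>?N\<close>; the conjunct \<open>j \<le> t i\<close> in \<open>?B\<close>, which is the
      semantics of padding, discards the extra indices.\<close>
    also have "\<dots> \<longleftrightarrow> (\<forall>i\<in>{1..m}. (\<exists>k. \<forall>n\<ge>k. ?A i n) \<longrightarrow> (\<exists>j\<in>{1..?N}. \<exists>k. \<forall>n\<ge>k. ?B i j n))"
    proof -
      have "(\<exists>j\<in>{1..t i}. \<exists>k. \<forall>n\<ge>k. T i j \<in> label G (r n)) \<longleftrightarrow>
          (\<exists>j\<in>{1..?N}. \<exists>k. \<forall>n\<ge>k. ?B i j n)" if "i \<in> {1..m}" for i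
        using le[OF that] by (meson atLeastAtMost_iff le_trans order_refl)
      then show ?thesis by blast
    qed
    also have "\<dots> \<longleftrightarrow> ((\<forall>j\<in>{1..?N}. \<forall>k. \<exists>n\<ge>k. \<forall>i\<in>{1..m}. \<not> ?A i n \<or> \<not> ?B i j n) \<longrightarrow>
        (\<forall>i\<in>{1..m}. \<forall>k. \<exists>n\<ge>k. \<not> ?A i n))"
      by (rule mode_target_iff_gr1) (fact excl)
    also have "\<dots> \<longleftrightarrow> sat (label G \<circ> r) 0 \<phi>"
      unfolding assms(2) by (simp add: atLeastLessThanSuc_atLeastAtMost del: upt_Suc)
    finally show ?thesis .
  qed
  \<comment> \<open>Both sides contain only labelings of plays, so agreement on those words
    suffices.\<close>
  then show "game_words G \<phi>MT = game_words G \<phi>"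
    by (auto simp: game_words_def words_of_def)
qed

end
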